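(* Let $(\varGamma,C)$ be a split-step SUSYQW (the coin need not be anisotropic). Define the operator on $\ell^2(\mathbb Z)\oplus\ell^2(\mathbb Z)$ \[ \epsilon=\frac{1}{\sqrt2}\begin{pmatrix}\sqrt{1+p} & -\sqrt{1-p}\\ \sqrt{1-p}\,e^{-i\theta}L^* & \sqrt{1+p}\,e^{-i\theta}L^*\end{pmatrix} \] and operators $Q_{\epsilon_\pm}$ on $\ell^2(\mathbb Z)$ by \[ -2iQ_{\epsilon_\pm}=(1\pm p)e^{i\theta}Lb-(1\mp p)e^{-i\theta}\,\overline{b}\,L^*\pm|q|\big(a_2(\cdot+1)-a_1\big), \] where products denote composition with the multiplication operators by $b$, $\overline b$, and by the sequences $a_2(\cdot+1)=(a_2(x+1))_{x}$ and $a_1$. Then $\epsilon$ is unitary and \[ \epsilon^*Q\epsilon=\begin{pmatrix}0 & Q_{\epsilon_-}\\ Q_{\epsilon_+} & 0\end{pmatrix} \] with respect to $\mathcal H=\ell^2(\mathbb Z)\oplus\ell^2(\mathbb Z)$. Moreover, $(\varGamma,C)$ is Fredholm if and only if $Q_{\epsilon_+}$ is a Fredholm operator, and in that case \[ \operatorname{ind}(\varGamma,C)=\operatorname{ind}Q_{\epsilon_+}=\dim\ker Q_{\epsilon_+}-\dim\ker Q_{\epsilon_-}. \]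
   Context: Let $\mathcal H=\ell^2(\mathbb Z,\mathbb C^2)\cong\ell^2(\mathbb Z)\oplus\ell^2(\mathbb Z)$, $L$ the left shift $(L\Psi)(x)=\Psi(x+1)$ on $\ell^2(\mathbb Z)$. A split-step SUSYQW is the pair $\varGamma=\begin{pmatrix} p & qL\\ \overline{q}L^* & -p\end{pmatrix}$, $C=\begin{pmatrix} a_1 & \overline{b}\\ b & a_2\end{pmatrix}$ with $p\in\mathbb R$, $q\in\mathbb C\setminus\{0\}$, $p^2+|q|^2=1$, $\theta=\operatorname{Arg}q$, real sequences $a_1,a_2$ and complex sequence $b$ on $\mathbb Z$ (as multiplication operators) with $a_j(x)^2+|b(x)|^2=1$ and $b(x)(a_1(x)+a_2(x))=0$ for all $x$. $Q=[\varGamma,C]/(2i)$, $H=Q^2$, $\mathcal H_\pm=\ker(\varGamma\mp1)$, $Q_+=Q|_{\mathcal H_+}:\mathcal H_+\to\mathcal H_-$, $H_\pm=H|_{\mathcal H_\pm}$. $(\varGamma,C)$ is Fredholm if $Q_+$ is Fredholm; $\operatorname{ind}(\varGamma,C)=\dim\ker H_+-\dim\ker H_-$. *)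

theory Defs
  imports "HOL-Analysis.Analysis" "HOL-Library.Function_Algebras"
begin

text \<open>A space is given by a carrier set of vectors, a complex scalar multiplication
  and a (sesquilinear) inner product; operators are functions on the ambient type,
  restricted to the carrier.\<close>

definition ker_on :: "'v set \<Rightarrow> ('v \<Rightarrow> 'w::zero) \<Rightarrow> 'v set" where
  "ker_on X T = {u \<in> X. T u = 0}"

definition orth_on :: "('w \<Rightarrow> 'w \<Rightarrow> complex) \<Rightarrow> 'w set \<Rightarrow> 'w set \<Rightarrow> 'w set" where
  "orth_on ip Y S = {v \<in> Y. \<forall>u\<in>S. ip u v = 0}"

definition ip_norm :: "('v \<Rightarrow> 'v \<Rightarrow> complex) \<Rightarrow> 'v \<Rightarrow> real" where
  "ip_norm ip u = sqrt (Re (ip u u))"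

definition norm_closed_in :: "('v::ab_group_add \<Rightarrow> 'v \<Rightarrow> complex) \<Rightarrow> 'v set \<Rightarrow> 'v set \<Rightarrow> bool" where
  "norm_closed_in ip Y S \<longleftrightarrow>
     (\<forall>s y. (\<forall>n. s n \<in> S) \<and> y \<in> Y \<and> (\<lambda>n. ip_norm ip (s n - y)) \<longlonglongrightarrow> 0 \<longrightarrow> y \<in> S)"

definition bounded_linear_on ::
  "(complex \<Rightarrow> 'v \<Rightarrow> 'v) \<Rightarrow> (complex \<Rightarrow> 'w \<Rightarrow> 'w) \<Rightarrow> ('v \<Rightarrow> 'v \<Rightarrow> complex) \<Rightarrow> ('w \<Rightarrow> 'w \<Rightarrow> complex)
    \<Rightarrow> 'v::ab_group_add set \<Rightarrow> 'w::ab_group_add set \<Rightarrow> ('v \<Rightarrow> 'w) \<Rightarrow> bool" where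
  "bounded_linear_on scX scY ipX ipY X Y T \<longleftrightarrow>
     (\<forall>u\<in>X. T u \<in> Y) \<and>
     (\<forall>u\<in>X. \<forall>v\<in>X. T (u + v) = T u + T v) \<and>
     (\<forall>c. \<forall>u\<in>X. T (scX c u) = scY c (T u)) \<and>
     (\<exists>K. \<forall>u\<in>X. ip_norm ipY (T u) \<le> K * ip_norm ipX u)"

definition fin_dim :: "(complex \<Rightarrow> 'v \<Rightarrow> 'v) \<Rightarrow> 'v::ab_group_add set \<Rightarrow> bool" where
  "fin_dim sc S \<longleftrightarrow> (\<exists>B. finite B \<and> B \<subseteq> S \<and> module.span sc B = S)"

definition cdim :: "(complex \<Rightarrow> 'v \<Rightarrow> 'v) \<Rightarrow> 'v::ab_group_add set \<Rightarrow> nat" where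
  "cdim sc S = vector_space.dim sc S"

text \<open>Fredholm operator T : X \<rightarrow> Y between (closed subspaces of) Hilbert spaces:
  bounded linear, finite-dimensional kernel, closed range, finite-dimensional cokernel
  (cokernel realised as the orthogonal complement of the range in Y).\<close>
definition fredholm_on ::
  "(complex \<Rightarrow> 'v \<Rightarrow> 'v) \<Rightarrow> (complex \<Rightarrow> 'w \<Rightarrow> 'w) \<Rightarrow> ('v \<Rightarrow> 'v \<Rightarrow> complex) \<Rightarrow> ('w \<Rightarrow> 'w \<Rightarrow> complex)
    \<Rightarrow> 'v::ab_group_add set \<Rightarrow> 'w::ab_group_add set \<Rightarrow> ('v \<Rightarrow> 'w) \<Rightarrow> bool" where
  "fredholm_on scX scY ipX ipY X Y T \<longleftrightarrow>
     bounded_linear_on scX scY ipX ipY X Y T \<and>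
     fin_dim scX (ker_on X T) \<and>
     norm_closed_in ipY Y (T ` X) \<and>
     fin_dim scY (orth_on ipY Y (T ` X))"

definition fred_index ::
  "(complex \<Rightarrow> 'v \<Rightarrow> 'v) \<Rightarrow> (complex \<Rightarrow> 'w \<Rightarrow> 'w) \<Rightarrow> ('w \<Rightarrow> 'w \<Rightarrow> complex)
    \<Rightarrow> 'v::ab_group_add set \<Rightarrow> 'w::ab_group_add set \<Rightarrow> ('v \<Rightarrow> 'w) \<Rightarrow> int" where
  "fred_index scX scY ipY X Y T =
     int (cdim scX (ker_on X T)) - int (cdim scY (orth_on ipY Y (T ` X)))"

definition unitary_on :: "('v \<Rightarrow> 'v \<Rightarrow> complex) \<Rightarrow> 'v set \<Rightarrow> ('v \<Rightarrow> 'v) \<Rightarrow> bool" where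
  "unitary_on ip X U \<longleftrightarrow> bij_betw U X X \<and> (\<forall>u\<in>X. \<forall>v\<in>X. ip (U u) (U v) = ip u v)"

definition adjoint_on :: "('v \<Rightarrow> 'v \<Rightarrow> complex) \<Rightarrow> 'v set \<Rightarrow> ('v \<Rightarrow> 'v) \<Rightarrow> 'v \<Rightarrow> 'v" where
  "adjoint_on ip X T v = (THE w. w \<in> X \<and> (\<forall>u\<in>X. ip (T u) v = ip u w))"

type_synonym seq = "int \<Rightarrow> complex"
type_synonym seq2 = "seq \<times> seq"

definition l2 :: "seq set" where
  "l2 = {f. (\<lambda>x. (cmod (f x))\<^sup>2) summable_on UNIV}"

definition ip1 :: "seq \<Rightarrow> seq \<Rightarrow> complex" where
  "ip1 f g = (\<Sum>\<^sub>\<infinity>x. f x * cnj (g x))"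

definition sc1 :: "complex \<Rightarrow> seq \<Rightarrow> seq" where
  "sc1 c f = (\<lambda>x. c * f x)"

definition H2 :: "seq2 set" where
  "H2 = l2 \<times> l2"

definition ip2 :: "seq2 \<Rightarrow> seq2 \<Rightarrow> complex" where
  "ip2 u v = ip1 (fst u) (fst v) + ip1 (snd u) (snd v)"

definition sc2 :: "complex \<Rightarrow> seq2 \<Rightarrow> seq2" where
  "sc2 c u = (sc1 c (fst u), sc1 c (snd u))"

definition Lsh :: "seq \<Rightarrow> seq" where "Lsh f = (\<lambda>x. f (x + 1))"
definition Lsh_adj :: "seq \<Rightarrow> seq" where "Lsh_adj f = (\<lambda>x. f (x - 1))"

definition susyqw :: "real \<Rightarrow> complex \<Rightarrow> (int \<Rightarrow> real) \<Rightarrow> (int \<Rightarrow> real) \<Rightarrow> (int \<Rightarrow> complex) \<Rightarrow> bool" where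
  "susyqw p q a1 a2 b \<longleftrightarrow> q \<noteq> 0 \<and> p\<^sup>2 + (cmod q)\<^sup>2 = 1 \<and>
     (\<forall>x. (a1 x)\<^sup>2 + (cmod (b x))\<^sup>2 = 1) \<and> (\<forall>x. (a2 x)\<^sup>2 + (cmod (b x))\<^sup>2 = 1) \<and>
     (\<forall>x. b x * complex_of_real (a1 x + a2 x) = 0)"

definition Gam :: "real \<Rightarrow> complex \<Rightarrow> seq2 \<Rightarrow> seq2" where
  "Gam p q u = ((\<lambda>x. p * fst u x + q * Lsh (snd u) x),
               (\<lambda>x. cnj q * Lsh_adj (fst u) x - p * snd u x))"

definition Coin :: "(int \<Rightarrow> real) \<Rightarrow> (int \<Rightarrow> real) \<Rightarrow> (int \<Rightarrow> complex) \<Rightarrow> seq2 \<Rightarrow> seq2" where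
  "Coin a1 a2 b u = ((\<lambda>x. a1 x * fst u x + cnj (b x) * snd u x),
                    (\<lambda>x. b x * fst u x + a2 x * snd u x))"

definition Qop :: "real \<Rightarrow> complex \<Rightarrow> (int \<Rightarrow> real) \<Rightarrow> (int \<Rightarrow> real) \<Rightarrow> (int \<Rightarrow> complex) \<Rightarrow> seq2 \<Rightarrow> seq2" where
  "Qop p q a1 a2 b u = sc2 (1 / (2 * \<i>)) (Gam p q (Coin a1 a2 b u) - Coin a1 a2 b (Gam p q u))"

definition Hop :: "real \<Rightarrow> complex \<Rightarrow> (int \<Rightarrow> real) \<Rightarrow> (int \<Rightarrow> real) \<Rightarrow> (int \<Rightarrow> complex) \<Rightarrow> seq2 \<Rightarrow> seq2" where
  "Hop p q a1 a2 b u = Qop p q a1 a2 b (Qop p q a1 a2 b u)"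

definition Hplus :: "real \<Rightarrow> complex \<Rightarrow> seq2 set" where
  "Hplus p q = {u \<in> H2. Gam p q u = u}"

definition Hminus :: "real \<Rightarrow> complex \<Rightarrow> seq2 set" where
  "Hminus p q = {u \<in> H2. Gam p q u = - u}"

definition susy_fredholm :: "real \<Rightarrow> complex \<Rightarrow> (int \<Rightarrow> real) \<Rightarrow> (int \<Rightarrow> real) \<Rightarrow> (int \<Rightarrow> complex) \<Rightarrow> bool" where
  "susy_fredholm p q a1 a2 b \<longleftrightarrow>
     fredholm_on sc2 sc2 ip2 ip2 (Hplus p q) (Hminus p q) (Qop p q a1 a2 b)"

definition susy_index :: "real \<Rightarrow> complex \<Rightarrow> (int \<Rightarrow> real) \<Rightarrow> (int \<Rightarrow> real) \<Rightarrow> (int \<Rightarrow> complex) \<Rightarrow> int" where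
  "susy_index p q a1 a2 b =
     int (cdim sc2 (ker_on (Hplus p q) (Hop p q a1 a2 b)))
     - int (cdim sc2 (ker_on (Hminus p q) (Hop p q a1 a2 b)))"

definition eps :: "real \<Rightarrow> complex \<Rightarrow> seq2 \<Rightarrow> seq2" where
  "eps p q u =
     ((\<lambda>x. (complex_of_real (sqrt (1 + p)) * fst u x - complex_of_real (sqrt (1 - p)) * snd u x)
              / complex_of_real (sqrt 2)),
      (\<lambda>x. (complex_of_real (sqrt (1 - p)) * (exp (- \<i> * complex_of_real (Arg q)) * Lsh_adj (fst u) x)
            + complex_of_real (sqrt (1 + p)) * (exp (- \<i> * complex_of_real (Arg q)) * Lsh_adj (snd u) x))
              / complex_of_real (sqrt 2)))"

text \<open>Q_{\<epsilon>\<pm>}, with s = 1 for + and s = -1 for -, defined through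
  -2i Q_{\<epsilon>\<pm>} = (1\<pm>p) e^{i\<theta>} L b - (1\<mp>p) e^{-i\<theta>} conj(b) L* \<pm> |q| (a_2(.+1) - a_1).\<close>
definition Qeps :: "real \<Rightarrow> real \<Rightarrow> complex \<Rightarrow> (int \<Rightarrow> real) \<Rightarrow> (int \<Rightarrow> real) \<Rightarrow> (int \<Rightarrow> complex) \<Rightarrow> seq \<Rightarrow> seq" where
  "Qeps s p q a1 a2 b f = (\<lambda>x.
     ((1 + s * p) * exp (\<i> * Arg q) * Lsh (\<lambda>y. b y * f y) x
      - (1 - s * p) * exp (- \<i> * Arg q) * (cnj (b x) * Lsh_adj f x)
      + complex_of_real (s * cmod q) * (complex_of_real (a2 (x + 1) - a1 x) * f x)) / (- 2 * \<i>))"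

end

theory Submission
  imports Defs
begin

text \<open>The unitary \<open>\<epsilon>\<close> diagonalises \<open>\<Gamma>\<close>: it maps the first summand of
  \<open>\<ell>\<^sup>2 \<oplus> \<ell>\<^sup>2\<close> onto \<open>\<H>\<^sub>+\<close> and the second onto \<open>\<H>\<^sub>-\<close>. Since \<open>Q\<close> anticommutes with \<open>\<Gamma>\<close>, it becomes
  off-diagonal, with entries found by a pointwise computation, and \<open>Q\<^sub>+\<close> is unitarily equivalent to
  \<open>Q\<^sub>\<epsilon>\<^sub>+\<close>, which transfers the Fredholm property. As \<open>Q\<close> is self-adjoint, \<open>Q\<^sub>\<epsilon>\<^sub>-\<close> is
  the adjoint of \<open>Q\<^sub>\<epsilon>\<^sub>+\<close>; hence the kernels of their products are the kernels of the right-hand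
  factors, and the cokernel of \<open>Q\<^sub>\<epsilon>\<^sub>+\<close> is the kernel of \<open>Q\<^sub>\<epsilon>\<^sub>-\<close>.\<close>

section \<open>Unitary maps between complex inner product spaces\<close>

text \<open>Linearity and injectivity are required on the whole ambient type, not only on the carrier,
  so that images of spans and dimensions need no relativisation.\<close>

definition unitary_map ::
  "(complex \<Rightarrow> 'v \<Rightarrow> 'v) \<Rightarrow> (complex \<Rightarrow> 'w \<Rightarrow> 'w) \<Rightarrow> ('v \<Rightarrow> 'v \<Rightarrow> complex) \<Rightarrow> ('w \<Rightarrow> 'w \<Rightarrow> complex)
    \<Rightarrow> 'v::ab_group_add set \<Rightarrow> 'w::ab_group_add set \<Rightarrow> ('v \<Rightarrow> 'w) \<Rightarrow> bool" where
  "unitary_map scX scY ipX ipY X Y J \<longleftrightarrow>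
     Vector_Spaces.linear scX scY J \<and> inj J \<and> J ` X = Y \<and>
     (\<forall>u\<in>X. \<forall>v\<in>X. ipY (J u) (J v) = ipX u v)"

text \<open>A linear map commutes with spans, and injectivity cancels it from an equation between
  images.\<close>

lemma fin_dim_image_iff:
  assumes "Vector_Spaces.linear s1 s2 f" and "inj f"
  shows "fin_dim s2 (f ` S) \<longleftrightarrow> fin_dim s1 S"
proof -
  interpret f: Vector_Spaces.linear s1 s2 f by fact
  show ?thesis
  proof
    assume "fin_dim s2 (f ` S)"
    then obtain B where B: "finite B" "B \<subseteq> f ` S" "module.span s2 B = f ` S"
      by (auto simp: fin_dim_def)
    then obtain A where A: "A \<subseteq> S" "finite A" "B = f ` A"
      by (meson finite_subset_image)
    have "f ` module.span s1 A = f ` S"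
      using B A f.span_image by simp
    then have "module.span s1 A = S"
      using assms(2) by (simp add: inj_image_eq_iff)
    with A show "fin_dim s1 S"
      by (auto simp: fin_dim_def)
  next
    assume "fin_dim s1 S"
    then obtain B where B: "finite B" "B \<subseteq> S" "module.span s1 B = S"
      by (auto simp: fin_dim_def)
    have "module.span s2 (f ` B) = f ` S"
      using f.span_image[of B] B by simp
    with B show "fin_dim s2 (f ` S)"
      unfolding fin_dim_def by (metis finite_imageI image_mono)
  qed
qed

text \<open>A basis of \<open>S\<close> is carried to a basis of the image with the same
  cardinality. An infinite basis is covered as well, with the default dimension 0 on both
  sides.\<close>

lemma cdim_image:
  assumes "Vector_Spaces.linear s1 s2 f" and "inj f"
  shows "cdim s2 (f ` S) = cdim s1 S"
proof -
  interpret f: Vector_Spaces.linear s1 s2 f by fact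
  obtain B where B: "B \<subseteq> S" "f.vs1.independent B" "S \<subseteq> f.vs1.span B" "card B = f.vs1.dim S"
    using f.vs1.basis_exists[of S] by auto
  have "f.vs2.independent (f ` B)"
    using f.independent_injective_image[OF B(2)] assms(2) by (auto intro: inj_on_subset)
  moreover have "f.vs2.span (f ` B) = f.vs2.span (f ` S)"
    using B f.vs1.span_mono[OF B(1)] f.vs1.span_minimal[OF B(3)] by (auto simp: f.span_image)
  moreover have "card (f ` B) = card B"
    using assms(2) by (auto intro: card_image inj_on_subset)
  ultimately show ?thesis
    using f.vs2.dim_eq_card[of "f ` B" "f ` S"] B(4) by (simp add: cdim_def)
qed

lemma bounded_linear_on_conj:
  assumes J: "unitary_map sX' sX ipX' ipX X' X J"
    and K: "unitary_map sY' sY ipY' ipY Y' Y K"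
    and add: "\<And>u v. u \<in> X' \<Longrightarrow> v \<in> X' \<Longrightarrow> u + v \<in> X'"
    and scale: "\<And>c u. u \<in> X' \<Longrightarrow> sX' c u \<in> X'"
    and T: "\<And>u. u \<in> X' \<Longrightarrow> T (J u) = K (T' u)"
  shows "bounded_linear_on sX sY ipX ipY X Y T \<longleftrightarrow> bounded_linear_on sX' sY' ipX' ipY' X' Y' T'"
proof -
  have linJ: "Vector_Spaces.linear sX' sX J" and linK: "Vector_Spaces.linear sY' sY K"
    and injK: "inj K" and X: "X = J ` X'" and Y: "Y = K ` Y'"
    and isoJ: "\<And>u v. u \<in> X' \<Longrightarrow> v \<in> X' \<Longrightarrow> ipX (J u) (J v) = ipX' u v"
    and isoK: "\<And>u v. u \<in> Y' \<Longrightarrow> v \<in> Y' \<Longrightarrow> ipY (K u) (K v) = ipY' u v"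
    using J K by (auto simp: unitary_map_def)
  interpret J: Vector_Spaces.linear sX' sX J by (rule linJ)
  interpret K: Vector_Spaces.linear sY' sY K by (rule linK)
  have range: "(\<forall>u\<in>X. T u \<in> Y) \<longleftrightarrow> (\<forall>u\<in>X'. T' u \<in> Y')"
    using injK by (auto simp: X Y T inj_image_mem_iff)
  have plus: "(\<forall>u\<in>X. \<forall>v\<in>X. T (u + v) = T u + T v)
      \<longleftrightarrow> (\<forall>u\<in>X'. \<forall>v\<in>X'. T' (u + v) = T' u + T' v)"
    by (simp add: X T add J.add[symmetric] K.add[symmetric] inj_eq[OF injK])
  have smult: "(\<forall>c. \<forall>u\<in>X. T (sX c u) = sY c (T u)) \<longleftrightarrow> (\<forall>c. \<forall>u\<in>X'. T' (sX' c u) = sY' c (T' u))"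
    by (simp add: X T scale J.scale[symmetric] K.scale[symmetric] inj_eq[OF injK])
  \<comment> \<open>\<open>K\<close> preserves norms only on \<open>Y'\<close>, so the range clause
    has to be available first.\<close>
  have bound: "(\<exists>C. \<forall>u\<in>X. ip_norm ipY (T u) \<le> C * ip_norm ipX u)
      \<longleftrightarrow> (\<exists>C. \<forall>u\<in>X'. ip_norm ipY' (T' u) \<le> C * ip_norm ipX' u)"
    if "\<forall>u\<in>X'. T' u \<in> Y'"
    using that by (simp add: X T ip_norm_def isoJ isoK)
  show ?thesis
    unfolding bounded_linear_on_def range plus smult using bound by blast
qed

text \<open>\<open>K\<close> preserves distances between points of \<open>Y'\<close>, so convergent
  sequences can be pushed forward and pulled back.\<close>

lemma norm_closed_in_image_iff:
  assumes K: "unitary_map sY' sY ipY' ipY Y' Y K"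
    and diff: "\<And>u v. u \<in> Y' \<Longrightarrow> v \<in> Y' \<Longrightarrow> u - v \<in> Y'"
    and S: "S \<subseteq> Y'"
  shows "norm_closed_in ipY Y (K ` S) \<longleftrightarrow> norm_closed_in ipY' Y' S"
proof -
  have linK: "Vector_Spaces.linear sY' sY K" and injK: "inj K" and Y: "Y = K ` Y'"
    and isoK: "\<And>u v. u \<in> Y' \<Longrightarrow> v \<in> Y' \<Longrightarrow> ipY (K u) (K v) = ipY' u v"
    using K by (auto simp: unitary_map_def)
  interpret K: Vector_Spaces.linear sY' sY K by (rule linK)
  have iso: "ip_norm ipY (K u - K v) = ip_norm ipY' (u - v)" if "u \<in> S" "v \<in> Y'" for u v
    using that S diff[of u v] by (simp add: ip_norm_def isoK K.diff[symmetric] subset_iff)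
  show ?thesis
  proof
    assume cl: "norm_closed_in ipY Y (K ` S)"
    show "norm_closed_in ipY' Y' S"
      unfolding norm_closed_in_def
    proof (intro allI impI, elim conjE)
      fix s y assume "\<forall>n. s n \<in> S" "y \<in> Y'" "(\<lambda>n. ip_norm ipY' (s n - y)) \<longlonglongrightarrow> 0"
      then have "\<forall>n. K (s n) \<in> K ` S" "K y \<in> Y" "(\<lambda>n. ip_norm ipY (K (s n) - K y)) \<longlonglongrightarrow> 0"
        by (auto simp: Y iso)
      then have "K y \<in> K ` S"
        using cl[unfolded norm_closed_in_def, rule_format, of "\<lambda>n. K (s n)" "K y"] by blast
      then show "y \<in> S"
        using injK by (simp add: inj_image_mem_iff)
    qed
  next
    assume cl: "norm_closed_in ipY' Y' S"
    show "norm_closed_in ipY Y (K ` S)"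
      unfolding norm_closed_in_def
    proof (intro allI impI, elim conjE)
      fix s y assume s: "\<forall>n. s n \<in> K ` S" and y: "y \<in> Y"
        and lim: "(\<lambda>n. ip_norm ipY (s n - y)) \<longlonglongrightarrow> 0"
      from s have "\<forall>n. \<exists>t. t \<in> S \<and> s n = K t"
        by auto
      then obtain s' where s': "\<And>n. s' n \<in> S" "\<And>n. s n = K (s' n)"
        using choice[of "\<lambda>n t. t \<in> S \<and> s n = K t"] by blast
      from y obtain y' where y': "y' \<in> Y'" "y = K y'"
        by (auto simp: Y)
      have "(\<lambda>n. ip_norm ipY' (s' n - y')) \<longlonglongrightarrow> 0"
        using lim by (simp add: s' y' iso)
      then have "y' \<in> S"
        using cl[unfolded norm_closed_in_def, rule_format, of s' y'] s' y' by blast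
      then show "y \<in> K ` S"
        by (simp add: y')
    qed
  qed
qed

text \<open>The intertwining relation carries kernel, range and cokernel of \<open>T'\<close> to
  those of \<open>T\<close>, the kernel by \<open>J\<close> and the other two by
  \<open>K\<close>.\<close>

lemma fredholm_on_conj:
  assumes J: "unitary_map sX' sX ipX' ipX X' X J"
    and K: "unitary_map sY' sY ipY' ipY Y' Y K"
    and add: "\<And>u v. u \<in> X' \<Longrightarrow> v \<in> X' \<Longrightarrow> u + v \<in> X'"
    and scale: "\<And>c u. u \<in> X' \<Longrightarrow> sX' c u \<in> X'"
    and diff: "\<And>u v. u \<in> Y' \<Longrightarrow> v \<in> Y' \<Longrightarrow> u - v \<in> Y'"
    and T: "\<And>u. u \<in> X' \<Longrightarrow> T (J u) = K (T' u)"
  shows "fredholm_on sX sY ipX ipY X Y T \<longleftrightarrow> fredholm_on sX' sY' ipX' ipY' X' Y' T'"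
proof -
  have linJ: "Vector_Spaces.linear sX' sX J" and injJ: "inj J" and X: "X = J ` X'"
    and linK: "Vector_Spaces.linear sY' sY K" and injK: "inj K" and Y: "Y = K ` Y'"
    and isoK: "\<And>u v. u \<in> Y' \<Longrightarrow> v \<in> Y' \<Longrightarrow> ipY (K u) (K v) = ipY' u v"
    using J K by (auto simp: unitary_map_def)
  interpret K: Vector_Spaces.linear sY' sY K by (rule linK)
  have K0: "K u = 0 \<longleftrightarrow> u = 0" for u
    using injK K.zero by (metis injD)
  have ker: "ker_on X T = J ` ker_on X' T'"
    by (auto simp: ker_on_def X T K0)
  have ran: "T ` X = K ` T' ` X'"
    by (auto simp: X T image_image)
  have orth: "orth_on ipY Y (T ` X) = K ` orth_on ipY' Y' (T' ` X')" if "T' ` X' \<subseteq> Y'"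
    using that unfolding ran by (fastforce simp: orth_on_def Y isoK)
  have blin: "bounded_linear_on sX sY ipX ipY X Y T \<longleftrightarrow> bounded_linear_on sX' sY' ipX' ipY' X' Y' T'"
    by (rule bounded_linear_on_conj[OF J K]) (fact add scale T)+
  show ?thesis
  \<comment> \<open>The description of the cokernel needs \<open>T'\<close> to map into
    \<open>Y'\<close>, which boundedness supplies; without boundedness both sides are false.\<close>
  proof (cases "bounded_linear_on sX' sY' ipX' ipY' X' Y' T'")
    case True
    then have *: "T' ` X' \<subseteq> Y'"
      by (auto simp: bounded_linear_on_def)
    show ?thesis
      unfolding fredholm_on_def ker orth[OF *] unfolding ran
      by (simp add: blin fin_dim_image_iff[OF linJ injJ] fin_dim_image_iff[OF linK injK]
          norm_closed_in_image_iff[OF K diff *])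
  next
    case False
    then show ?thesis
      by (simp add: fredholm_on_def blin)
  qed
qed

section \<open>Square-summable sequences\<close>

interpretation sc1: vector_space sc1
  by unfold_locales (auto simp: sc1_def fun_eq_iff algebra_simps)

interpretation sc2: vector_space sc2
  by unfold_locales (auto simp: sc2_def sc1_def fun_eq_iff algebra_simps prod_eq_iff)

lemma l2_mult_bounded:
  assumes f: "f \<in> l2" and d: "\<And>x. cmod (d x) \<le> B"
  shows "(\<lambda>x. d x * f x) \<in> l2"
proof -
  have "(\<lambda>x. B\<^sup>2 * (cmod (f x))\<^sup>2) summable_on UNIV"
    using f by (auto simp: l2_def intro: summable_on_cmult_right)
  then have "(\<lambda>x. (cmod (d x * f x))\<^sup>2) summable_on UNIV"
  proof (rule summable_on_comparison_test)
    fix x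
    have "(cmod (d x))\<^sup>2 \<le> B\<^sup>2"
      using d[of x] by (simp add: power_mono)
    then show "(cmod (d x * f x))\<^sup>2 \<le> B\<^sup>2 * (cmod (f x))\<^sup>2"
      by (simp add: norm_mult power_mult_distrib mult_right_mono)
  qed simp
  then show ?thesis
    by (simp add: l2_def)
qed

lemma l2_scale: "f \<in> l2 \<Longrightarrow> (\<lambda>x. c * f x) \<in> l2"
  by (rule l2_mult_bounded[where B = "cmod c"]) auto

lemma l2_add:
  assumes "f \<in> l2" "g \<in> l2"
  shows "(\<lambda>x. f x + g x) \<in> l2"
proof -
  have "(\<lambda>x. 2 * (cmod (f x))\<^sup>2 + 2 * (cmod (g x))\<^sup>2) summable_on UNIV"
    using assms by (auto simp: l2_def intro!: summable_on_cmult_right summable_on_add)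
  then have "(\<lambda>x. (cmod (f x + g x))\<^sup>2) summable_on UNIV"
  proof (rule summable_on_comparison_test)
    fix x
    have "(cmod (f x + g x))\<^sup>2 \<le> (cmod (f x) + cmod (g x))\<^sup>2"
      by (simp add: norm_triangle_ineq power_mono)
    also have "\<dots> \<le> 2 * (cmod (f x))\<^sup>2 + 2 * (cmod (g x))\<^sup>2"
      using sum_squares_bound[of "cmod (f x)" "cmod (g x)"] by (simp add: power2_sum)
    finally show "(cmod (f x + g x))\<^sup>2 \<le> 2 * (cmod (f x))\<^sup>2 + 2 * (cmod (g x))\<^sup>2" .
  qed simp
  then show ?thesis
    by (simp add: l2_def)
qed

lemma l2_diff: "f \<in> l2 \<Longrightarrow> g \<in> l2 \<Longrightarrow> (\<lambda>x. f x - g x) \<in> l2"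
  using l2_add[OF _ l2_scale[of g "-1"]] by simp

lemma l2_zero: "0 \<in> l2"
  by (simp add: l2_def)

lemma l2_plus_closed: "f \<in> l2 \<Longrightarrow> g \<in> l2 \<Longrightarrow> f + g \<in> l2"
  and l2_minus_closed: "f \<in> l2 \<Longrightarrow> g \<in> l2 \<Longrightarrow> f - g \<in> l2"
  and l2_sc1_closed: "f \<in> l2 \<Longrightarrow> sc1 c f \<in> l2"
  using l2_add[of f g] l2_diff[of f g] l2_scale[of f c]
  by (simp_all add: plus_fun_def fun_diff_def sc1_def)

lemma bij_int_shift: "bij (\<lambda>x::int. x + k)"
  by (rule bij_betwI[where g = "\<lambda>x. x - k"]) auto

lemma l2_shift: "f \<in> l2 \<Longrightarrow> (\<lambda>x. f (x + k)) \<in> l2"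
  unfolding l2_def
  using summable_on_reindex_bij_betw[OF bij_int_shift[of k], where f = "\<lambda>x. (cmod (f x))\<^sup>2"] by simp

lemma l2_shift_back: "f \<in> l2 \<Longrightarrow> (\<lambda>x. f (x - k)) \<in> l2"
  using l2_shift[of f "-k"] by simp

lemma ip1_shift: "ip1 (\<lambda>x. f (x + k)) (\<lambda>x. g (x + k)) = ip1 f g"
  unfolding ip1_def
  using infsum_reindex_bij_betw[OF bij_int_shift[of k], where f = "\<lambda>x. f x * cnj (g x)"] by simp

text \<open>An infinite sum that does not converge has the value 0 by default, so additivity of
  \<open>ip1\<close> rests on summability. The bound is the inequality between geometric and
  arithmetic means.\<close>

lemma ip1_summable:
  assumes "f \<in> l2" "g \<in> l2"
  shows "(\<lambda>x. f x * cnj (g x)) summable_on UNIV"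
proof (rule abs_summable_summable)
  have "(\<lambda>x. (cmod (f x))\<^sup>2 + (cmod (g x))\<^sup>2) summable_on UNIV"
    using assms by (auto simp: l2_def intro!: summable_on_add)
  then show "(\<lambda>x. norm (f x * cnj (g x))) summable_on UNIV"
  proof (rule summable_on_comparison_test)
    fix x
    have "2 * (cmod (f x) * cmod (g x)) \<le> (cmod (f x))\<^sup>2 + (cmod (g x))\<^sup>2"
      using sum_squares_bound[of "cmod (f x)" "cmod (g x)"] by simp
    moreover have "0 \<le> cmod (f x) * cmod (g x)"
      by simp
    ultimately have "cmod (f x) * cmod (g x) \<le> (cmod (f x))\<^sup>2 + (cmod (g x))\<^sup>2"
      by linarith
    then show "norm (f x * cnj (g x)) \<le> (cmod (f x))\<^sup>2 + (cmod (g x))\<^sup>2"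
      by (simp add: norm_mult)
  qed simp
qed

lemma ip1_cnj: "ip1 g f = cnj (ip1 f g)"
  by (simp add: ip1_def infsum_cnj[symmetric] mult.commute del: infsum_cnj)

lemma ip1_add_left:
  assumes "f \<in> l2" "g \<in> l2" "h \<in> l2"
  shows "ip1 (\<lambda>x. f x + g x) h = ip1 f h + ip1 g h"
  using infsum_add[OF ip1_summable[OF assms(1,3)] ip1_summable[OF assms(2,3)]]
  by (simp add: ip1_def distrib_right)

lemma ip1_scale_left: "ip1 (\<lambda>x. c * f x) h = c * ip1 f h"
  by (simp add: ip1_def mult.assoc infsum_cmult_right')

lemma ip1_add_right:
  assumes "f \<in> l2" "g \<in> l2" "h \<in> l2"
  shows "ip1 h (\<lambda>x. f x + g x) = ip1 h f + ip1 h g"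
  by (subst (1 2 3) ip1_cnj) (simp add: ip1_add_left assms)

lemma ip1_scale_right: "ip1 h (\<lambda>x. c * f x) = cnj c * ip1 h f"
  by (subst (1 2) ip1_cnj) (simp add: ip1_scale_left)

lemma ip1_zero: "ip1 0 f = 0" "ip1 f 0 = 0"
  by (simp_all add: ip1_def)

lemma ip1_self_eq_0:
  assumes "f \<in> l2" "ip1 f f = 0"
  shows "f = 0"
proof
  fix x
  have "(\<Sum>\<^sub>\<infinity>x. (cmod (f x))\<^sup>2) = 0"
    using infsum_Re[OF ip1_summable[OF assms(1,1)]] assms(2)
    by (simp add: ip1_def cmod_power2 flip: power2_eq_square)
  then have "(cmod (f x))\<^sup>2 = 0"
    using assms(1) by (intro nonneg_infsum_le_0D[where A = UNIV and f = "\<lambda>x. (cmod (f x))\<^sup>2"])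
      (auto simp: l2_def)
  then show "f x = 0 x"
    by simp
qed

text \<open>Nondegeneracy, which makes the description in \<open>adjoint_on\<close> unique. Test
  vectors supported in one summand reduce it to \<open>l2\<close>, where the difference is tested
  against itself.\<close>

lemma ip2_right_unique:
  assumes "w \<in> H2" "v \<in> H2" "\<And>u. u \<in> H2 \<Longrightarrow> ip2 u w = ip2 u v"
  shows "w = v"
proof -
  have unique: "g = h" if "g \<in> l2" "h \<in> l2" "\<And>f. f \<in> l2 \<Longrightarrow> ip1 f g = ip1 f h" for g h
  proof -
    have d: "g - h \<in> l2"
      using that by (simp add: l2_minus_closed)
    have "ip1 (g - h) (g - h) = ip1 (g - h) (\<lambda>x. g x + (-1) * h x)"
      by (simp add: fun_diff_def)
    also have "\<dots> = 0"
      unfolding ip1_add_right[OF that(1) l2_scale[OF that(2)] d] ip1_scale_right using that(3)[OF d] by simp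
    finally show ?thesis
      using ip1_self_eq_0[OF d] by simp
  qed
  have "fst w = fst v"
    using assms(1,2) assms(3)[of "(f, 0)" for f]
    by (intro unique) (auto simp: H2_def ip2_def ip1_zero l2_zero)
  moreover have "snd w = snd v"
    using assms(1,2) assms(3)[of "(0, f)" for f]
    by (intro unique) (auto simp: H2_def ip2_def ip1_zero l2_zero)
  ultimately show ?thesis
    by (simp add: prod_eq_iff)
qed

section \<open>The split-step walk\<close>

lemma Arg_polar: "q = complex_of_real (cmod q) * exp (\<i> * complex_of_real (Arg q))"
  by (metis Arg_eq mult_zero_left norm_zero of_real_0)

locale split_step =
  fixes p :: real and q :: complex and a1 a2 :: "int \<Rightarrow> real" and b :: "int \<Rightarrow> complex"
  assumes walk: "susyqw p q a1 a2 b"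
begin

text \<open>Half-angle parametrisation: \<open>p = c\<^sup>2 - s\<^sup>2\<close> and \<open>|q| = 2cs\<close> with \<open>c\<^sup>2 + s\<^sup>2 = 1\<close>, so that
  every coefficient becomes a polynomial in \<open>c\<close>, \<open>s\<close> and the phases \<open>\<omega>\<close>, \<open>\<omega>'\<close>.\<close>

definition c :: complex where "c = complex_of_real (sqrt (1 + p) / sqrt 2)"
definition s :: complex where "s = complex_of_real (sqrt (1 - p) / sqrt 2)"
definition \<omega> :: complex where "\<omega> = exp (\<i> * complex_of_real (Arg q))"
definition \<omega>' :: complex where "\<omega>' = exp (- \<i> * complex_of_real (Arg q))"

text \<open>Strictness comes from \<open>q \<noteq> 0\<close>. The bound keeps \<open>1 + p\<close>
  and \<open>1 - p\<close> nonnegative, so that their square roots square back.\<close>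

lemma abs_p: "\<bar>p\<bar> < 1"
proof -
  have "p\<^sup>2 < 1"
    using walk by (auto simp: susyqw_def) (metis less_add_same_cancel1 zero_less_norm_iff zero_less_power)
  then show ?thesis
    by (simp add: abs_square_less_1)
qed

lemma c_sq: "c * c = (1 + of_real p) / 2" and s_sq: "s * s = (1 - of_real p) / 2"
  using abs_p by (simp_all add: c_def s_def flip: of_real_mult)

lemma c_s_sq: "c * c + s * s = 1"
  by (simp add: c_sq s_sq field_simps)

lemma p_eq: "of_real p = c * c - s * s"
  by (simp add: c_sq s_sq field_simps)

lemma cmod_q: "of_real (cmod q) = 2 * (c * s)"
proof -
  have "(cmod q)\<^sup>2 = (1 + p) * (1 - p)"
    using walk by (simp add: susyqw_def algebra_simps power2_eq_square)
  then have "cmod q = sqrt (1 + p) * sqrt (1 - p)"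
    by (metis norm_ge_zero real_sqrt_mult real_sqrt_unique)
  then show ?thesis
    by (simp add: c_def s_def flip: of_real_mult)
qed

lemma \<omega>_mult: "\<omega> * \<omega>' = 1"
  by (simp add: \<omega>_def \<omega>'_def flip: exp_add)

lemma q_eq: "q = 2 * (c * s) * \<omega>"
  using Arg_polar[of q] by (simp add: cmod_q \<omega>_def)

lemma cnj_simps: "cnj c = c" "cnj s = s" "cnj \<omega> = \<omega>'" "cnj \<omega>' = \<omega>"
  by (simp_all add: c_def s_def \<omega>_def \<omega>'_def exp_cnj)

lemma cnj_q_eq: "cnj q = 2 * (c * s) * \<omega>'"
  by (subst q_eq) (simp add: cnj_simps)

section \<open>Conjugation of the walk by \<open>eps\<close>\<close>

lemma eps_eq:
  "eps p q u = ((\<lambda>x. c * fst u x - s * snd u x),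
                (\<lambda>x. \<omega>' * (s * fst u (x - 1) + c * snd u (x - 1))))"
  by (simp add: eps_def c_def s_def \<omega>'_def Lsh_adj_def fun_eq_iff diff_divide_distrib
      add_divide_distrib algebra_simps)

text \<open>The columns of \<open>eps\<close> are eigenvectors of \<open>Gam\<close> for the
  eigenvalues 1 and -1.\<close>

lemma Gam_eps: "Gam p q (eps p q u) = eps p q (fst u, - snd u)"
proof -
  have 1: "(c * c - s * s) * (c * f - s * g) + 2 * (c * s) * \<omega> * (\<omega>' * (s * f + c * g)) = c * f - s * (- g)"
    and 2: "2 * (c * s) * \<omega>' * (c * f - s * g) - (c * c - s * s) * (\<omega>' * (s * f + c * g))
      = \<omega>' * (s * f + c * (- g))" for f g
    using c_s_sq \<omega>_mult by algebra+
  show ?thesis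
    unfolding Gam_def eps_eq Lsh_def Lsh_adj_def p_eq cnj_q_eq
    \<comment> \<open>A single rewrite, because the right-hand side of \<open>q_eq\<close> contains
      \<open>q\<close> again inside \<omega>.\<close>
    by (subst q_eq) (simp add: 1 2)
qed

text \<open>The coefficients are \<open>1 + p = 2 c^2\<close>, \<open>1 - p = 2 s^2\<close> and
  \<open>|q| = 2 c s\<close>; their common factor 2 and the divisor \<open>-2 i\<close> leave the
  prefactor \<open>i\<close>.\<close>

lemma Qeps_plus_eq:
  "Qeps 1 p q a1 a2 b f = (\<lambda>x. \<i> * (c * c * \<omega> * (b (x + 1) * f (x + 1))
     - s * s * \<omega>' * (cnj (b x) * f (x - 1)) + c * s * (complex_of_real (a2 (x + 1) - a1 x) * f x)))"
proof -
  have "1 + complex_of_real p = 2 * (c * c)" "1 - complex_of_real p = 2 * (s * s)"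
    by (simp_all add: c_sq s_sq)
  then show ?thesis
    unfolding Qeps_def Lsh_def Lsh_adj_def \<omega>_def[symmetric] \<omega>'_def[symmetric]
    by (simp add: cmod_q fun_eq_iff)
qed

lemma Qeps_minus_eq:
  "Qeps (-1) p q a1 a2 b f = (\<lambda>x. \<i> * (s * s * \<omega> * (b (x + 1) * f (x + 1))
     - c * c * \<omega>' * (cnj (b x) * f (x - 1)) - c * s * (complex_of_real (a2 (x + 1) - a1 x) * f x)))"
proof -
  have "1 + complex_of_real p = 2 * (c * c)" "1 - complex_of_real p = 2 * (s * s)"
    by (simp_all add: c_sq s_sq)
  then show ?thesis
    unfolding Qeps_def Lsh_def Lsh_adj_def \<omega>_def[symmetric] \<omega>'_def[symmetric]
    by (simp add: cmod_q fun_eq_iff)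
qed

text \<open>The block form, stated as an intertwining relation. In the second term of the commutator
  \<open>Gam_eps\<close> replaces \<open>Gam\<close> by a sign change of the second component; what
  remains is a polynomial identity at each site.\<close>

lemma Qop_eps:
  "Qop p q a1 a2 b (eps p q u) = eps p q (Qeps (-1) p q a1 a2 b (snd u), Qeps 1 p q a1 a2 b (fst u))"
proof -
  \<comment> \<open>Here \<open>A\<close>, \<open>A'\<close>, \<open>B\<close>, \<open>B'\<close>
    stand for \<open>a1 x\<close>, \<open>a2 (x + 1)\<close>, \<open>b (x + 1)\<close>,
    \<open>cnj (b x)\<close>, and the suffixes \<open>1\<close> and \<open>m\<close> for the sites
    \<open>x + 1\<close> and \<open>x - 1\<close>.\<close>
  have fst_eq: "- (\<i> / 2) * ((c * c - s * s) * (A * (c * f - s * g) + B' * (\<omega>' * (s * fm + c * gm)))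
        + q * (B * (c * f1 - s * g1) + A' * (\<omega>' * (s * f + c * g)))
        - (A * (c * f - s * - g) + B' * (\<omega>' * (s * fm + c * - gm))))
      = c * (\<i> * (s * s * \<omega> * (B * g1) - c * c * \<omega>' * (B' * gm) - c * s * ((A' - A) * g)))
        - s * (\<i> * (c * c * \<omega> * (B * f1) - s * s * \<omega>' * (B' * fm) + c * s * ((A' - A) * f)))"
    for A A' B B' f f1 fm g g1 gm
    using c_s_sq \<omega>_mult q_eq by algebra
  \<comment> \<open>The right shift in the second row of \<open>eps\<close> moves all sites one step
    to the left: now \<open>A\<close>, \<open>A'\<close>, \<open>B\<close>, \<open>B'\<close> are
    \<open>a1 (x - 1)\<close>, \<open>a2 x\<close>, \<open>b x\<close>,
    \<open>cnj (b (x - 1))\<close>, and \<open>mm\<close> marks \<open>x - 2\<close>.\<close>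
  have snd_eq: "- (\<i> / 2) * (2 * (c * s) * \<omega>' * (A * (c * fm - s * gm) + B' * (\<omega>' * (s * fmm + c * gmm)))
        - (c * c - s * s) * (B * (c * f - s * g) + A' * (\<omega>' * (s * fm + c * gm)))
        - (B * (c * f - s * - g) + A' * (\<omega>' * (s * fm + c * - gm))))
      = \<omega>' * (s * (\<i> * (s * s * \<omega> * (B * g) - c * c * \<omega>' * (B' * gmm) - c * s * ((A' - A) * gm)))
        + c * (\<i> * (c * c * \<omega> * (B * f) - s * s * \<omega>' * (B' * fmm) + c * s * ((A' - A) * fm))))"
    for A A' B B' f fm fmm g gm gmm
    using c_s_sq \<omega>_mult by algebra
  have i: "1 / (2 * \<i>) = - (\<i> / 2)"
    by (simp add: field_simps)
  show ?thesis
    unfolding Qop_def Gam_eps i Qeps_plus_eq Qeps_minus_eq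
    unfolding Gam_def Coin_def eps_eq Lsh_def Lsh_adj_def sc2_def sc1_def p_eq cnj_q_eq
  proof (intro prod_eqI ext, goal_cases)
    case (1 x)
    show ?case
      by (simp only: fst_conv snd_conv fst_diff minus_apply uminus_apply of_real_diff
          add_diff_cancel_right') (rule fst_eq)
  next
    case (2 x)
    show ?case
      by (simp only: fst_conv snd_conv snd_diff minus_apply uminus_apply of_real_diff
          diff_add_cancel) (rule snd_eq)
  qed
qed

section \<open>Unitarity of \<open>eps\<close>\<close>

text \<open>The adjoint matrix of \<open>eps\<close>, in explicit form so that bijectivity is a
  pointwise check.\<close>

definition eps_inv :: "seq2 \<Rightarrow> seq2" where
  "eps_inv v = ((\<lambda>x. c * fst v x + \<omega> * (s * snd v (x + 1))),
                (\<lambda>x. \<omega> * (c * snd v (x + 1)) - s * fst v x))"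

lemma eps_eps_inv: "eps p q (eps_inv v) = v"
proof -
  have "c * (c * f + \<omega> * (s * g)) - s * (\<omega> * (c * g) - s * f) = f"
    and "\<omega>' * (s * (c * f + \<omega> * (s * g)) + c * (\<omega> * (c * g) - s * f)) = g" for f g
    using c_s_sq \<omega>_mult by algebra+
  then show ?thesis
    by (simp add: eps_eq eps_inv_def prod_eq_iff)
qed

lemma eps_inv_eps: "eps_inv (eps p q u) = u"
proof -
  have "c * (c * f - s * g) + \<omega> * (s * (\<omega>' * (s * f + c * g))) = f"
    and "\<omega> * (c * (\<omega>' * (s * f + c * g))) - s * (c * f - s * g) = g" for f g
    using c_s_sq \<omega>_mult by algebra+
  then show ?thesis
    by (simp add: eps_eq eps_inv_def prod_eq_iff)
qed

lemma inj_eps: "inj (eps p q)"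
  by (metis eps_inv_eps injI)

lemma eps_H2: "u \<in> H2 \<Longrightarrow> eps p q u \<in> H2"
  by (auto simp: eps_eq H2_def intro!: l2_add l2_diff l2_scale l2_shift_back)

lemma eps_inv_H2: "v \<in> H2 \<Longrightarrow> eps_inv v \<in> H2"
  unfolding eps_inv_def H2_def
  by (auto intro!: l2_add l2_diff l2_scale l2_shift)

text \<open>The phase and the shift in the second component preserve \<open>ip1\<close>. The mixed
  terms of the two components then cancel, and the others add up by \<open>c_s_sq\<close>.\<close>

lemma ip2_eps:
  assumes "u \<in> H2" "v \<in> H2"
  shows "ip2 (eps p q u) (eps p q v) = ip2 u v"
proof -
  obtain f g f' g' where uv: "u = (f, g)" "v = (f', g')" and l2: "f \<in> l2" "g \<in> l2" "f' \<in> l2" "g' \<in> l2"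
    using assms by (auto simp: H2_def)
  have lin: "ip1 (\<lambda>x. \<alpha> * f x + \<beta> * g x) (\<lambda>x. \<alpha> * f' x + \<beta> * g' x)
      = \<alpha> * cnj \<alpha> * ip1 f f' + \<alpha> * cnj \<beta> * ip1 f g' + \<beta> * cnj \<alpha> * ip1 g f' + \<beta> * cnj \<beta> * ip1 g g'"
    for \<alpha> \<beta>
    using l2 by (simp add: ip1_add_left ip1_add_right ip1_scale_left ip1_scale_right l2_add l2_scale
        algebra_simps)
  have fst: "ip1 (fst (eps p q u)) (fst (eps p q v))
      = c * c * ip1 f f' - c * s * ip1 f g' - s * c * ip1 g f' + s * s * ip1 g g'"
    using lin[of c "- s"] by (simp add: eps_eq uv cnj_simps)
  have "ip1 (snd (eps p q u)) (snd (eps p q v))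
      = \<omega>' * cnj \<omega>' * ip1 (\<lambda>x. s * f (x + -1) + c * g (x + -1)) (\<lambda>x. s * f' (x + -1) + c * g' (x + -1))"
    by (simp add: eps_eq uv ip1_scale_left ip1_scale_right)
  also have "\<dots> = ip1 (\<lambda>x. s * f x + c * g x) (\<lambda>x. s * f' x + c * g' x)"
    using ip1_shift[of "\<lambda>x. s * f x + c * g x" "-1" "\<lambda>x. s * f' x + c * g' x"] \<omega>_mult
    by (simp add: cnj_simps mult.commute)
  also have "\<dots> = s * s * ip1 f f' + s * c * ip1 f g' + c * s * ip1 g f' + c * c * ip1 g g'"
    using lin[of s c] by (simp add: cnj_simps)
  finally have "ip2 (eps p q u) (eps p q v) = (c * c + s * s) * (ip1 f f' + ip1 g g')"
    by (simp add: ip2_def fst algebra_simps)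
  then show ?thesis
    by (simp add: c_s_sq ip2_def uv)
qed

lemma eps_unitary: "unitary_on ip2 H2 (eps p q)"
proof -
  have "bij_betw (eps p q) H2 H2"
    by (rule bij_betwI[where g = eps_inv]) (auto simp: eps_H2 eps_inv_H2 eps_eps_inv eps_inv_eps)
  then show ?thesis
    by (simp add: unitary_on_def ip2_eps)
qed

text \<open>Since \<open>Qop_eps\<close> writes \<open>Q\<close> after \<open>eps\<close> as a value
  of \<open>eps\<close>, the adjoint is needed only on such values, where isometry exhibits
  \<open>w\<close> and nondegeneracy makes it unique.\<close>

lemma adjoint_eps:
  assumes "w \<in> H2"
  shows "adjoint_on ip2 H2 (eps p q) (eps p q w) = w"
  unfolding adjoint_on_def
proof (rule the_equality)
  show "w \<in> H2 \<and> (\<forall>u\<in>H2. ip2 (eps p q u) (eps p q w) = ip2 u w)"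
    using assms by (simp add: ip2_eps)
next
  fix v assume "v \<in> H2 \<and> (\<forall>u\<in>H2. ip2 (eps p q u) (eps p q w) = ip2 u v)"
  with assms show "v = w"
    by (intro ip2_right_unique) (auto simp: ip2_eps)
qed

section \<open>Eigenspaces of \<open>Gam\<close>\<close>

lemma linear_eps_fst: "Vector_Spaces.linear sc1 sc2 (\<lambda>f. eps p q (f, 0))"
  and linear_eps_snd: "Vector_Spaces.linear sc1 sc2 (\<lambda>f. eps p q (0, f))"
  by unfold_locales (auto simp: eps_eq sc1_def sc2_def prod_eq_iff fun_eq_iff algebra_simps)

text \<open>In the coordinates of \<open>eps\<close>, being fixed by \<open>Gam\<close> means
  \<open>- g = g\<close> for the second component, hence \<open>g = 0\<close>.\<close>

lemma Hplus_eq: "Hplus p q = (\<lambda>f. eps p q (f, 0)) ` l2"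
proof
  show "(\<lambda>f. eps p q (f, 0)) ` l2 \<subseteq> Hplus p q"
    by (auto simp: Hplus_def Gam_eps intro!: eps_H2) (auto simp: H2_def l2_zero)
  show "Hplus p q \<subseteq> (\<lambda>f. eps p q (f, 0)) ` l2"
  proof
    fix u assume "u \<in> Hplus p q"
    then have u: "u \<in> H2" "Gam p q u = u"
      by (auto simp: Hplus_def)
    obtain f g where fg: "eps_inv u = (f, g)" by force
    then have eps: "eps p q (f, g) = u" and "f \<in> l2"
      using eps_eps_inv[of u] eps_inv_H2[OF u(1)] by (auto simp: H2_def)
    have "eps p q (f, - g) = eps p q (f, g)"
      using u(2) Gam_eps[of "(f, g)"] eps by simp
    then have "- g = g"
      using injD[OF inj_eps] by blast
    then have "g = 0"
      by (auto simp: fun_eq_iff)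
    with eps \<open>f \<in> l2\<close> show "u \<in> (\<lambda>f. eps p q (f, 0)) ` l2"
      by auto
  qed
qed

lemma Hminus_eq: "Hminus p q = (\<lambda>f. eps p q (0, f)) ` l2"
proof
  have neg: "- eps p q u = eps p q (- u)" for u
    by (auto simp: eps_eq prod_eq_iff fun_eq_iff algebra_simps)
  show "(\<lambda>f. eps p q (0, f)) ` l2 \<subseteq> Hminus p q"
    by (auto simp: Hminus_def Gam_eps neg intro!: eps_H2) (auto simp: H2_def l2_zero)
  show "Hminus p q \<subseteq> (\<lambda>f. eps p q (0, f)) ` l2"
  proof
    fix u assume "u \<in> Hminus p q"
    then have u: "u \<in> H2" "Gam p q u = - u"
      by (auto simp: Hminus_def)
    obtain f g where fg: "eps_inv u = (f, g)" by force
    then have eps: "eps p q (f, g) = u" and "g \<in> l2"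
      using eps_eps_inv[of u] eps_inv_H2[OF u(1)] by (auto simp: H2_def)
    have "eps p q (f, - g) = eps p q (- f, - g)"
      using u(2) Gam_eps[of "(f, g)"] eps neg[of "(f, g)"] by simp
    then have "- f = f"
      using injD[OF inj_eps] by (metis prod.inject)
    then have "f = 0"
      by (auto simp: fun_eq_iff)
    with eps \<open>g \<in> l2\<close> show "u \<in> (\<lambda>f. eps p q (0, f)) ` l2"
      by auto
  qed
qed

lemma ip2_Pair_zero: "ip2 (f, 0) (g, 0) = ip1 f g" "ip2 (0, f) (0, g) = ip1 f g"
  by (simp_all add: ip2_def ip1_zero)

lemma unitary_map_plus: "unitary_map sc1 sc2 ip1 ip2 l2 (Hplus p q) (\<lambda>f. eps p q (f, 0))"
  and unitary_map_minus: "unitary_map sc1 sc2 ip1 ip2 l2 (Hminus p q) (\<lambda>f. eps p q (0, f))"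
  using inj_eps
  by (auto simp: unitary_map_def linear_eps_fst linear_eps_snd Hplus_eq Hminus_eq ip2_eps H2_def
      l2_zero ip2_Pair_zero inj_def)

section \<open>The off-diagonal entries as mutually adjoint operators on \<open>l2\<close>\<close>

lemma Qeps_zero: "Qeps r p q a1 a2 b 0 = 0"
  by (simp add: Qeps_def Lsh_def Lsh_adj_def fun_eq_iff)

text \<open>These bounds make the multiplication operators preserve \<open>l2\<close>.\<close>

lemma coin_bounds: "cmod (b x) \<le> 1" "\<bar>a1 x\<bar> \<le> 1" "\<bar>a2 x\<bar> \<le> 1"
proof -
  have "(a1 x)\<^sup>2 + (cmod (b x))\<^sup>2 = 1" "(a2 x)\<^sup>2 + (cmod (b x))\<^sup>2 = 1"
    using walk by (auto simp: susyqw_def)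
  then have "(cmod (b x))\<^sup>2 \<le> 1" "(a1 x)\<^sup>2 \<le> 1" "(a2 x)\<^sup>2 \<le> 1"
    by (smt (verit) zero_le_power2)+
  then show "cmod (b x) \<le> 1" "\<bar>a1 x\<bar> \<le> 1" "\<bar>a2 x\<bar> \<le> 1"
    by (simp_all add: abs_square_le_1)
qed

lemma l2_terms:
  assumes "f \<in> l2"
  shows "(\<lambda>x. b (x + 1) * f (x + 1)) \<in> l2" "(\<lambda>x. cnj (b x) * f (x - 1)) \<in> l2"
    "(\<lambda>x. complex_of_real (a2 (x + 1) - a1 x) * f x) \<in> l2"
proof -
  show "(\<lambda>x. b (x + 1) * f (x + 1)) \<in> l2"
    using coin_bounds(1) assms by (intro l2_mult_bounded[where B = 1] l2_shift) auto
  show "(\<lambda>x. cnj (b x) * f (x - 1)) \<in> l2"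
    using coin_bounds(1) assms by (intro l2_mult_bounded[where B = 1] l2_shift_back) auto
  have "cmod (complex_of_real (a2 (x + 1) - a1 x)) \<le> 2" for x
    using coin_bounds(2)[of x] coin_bounds(3)[of "x + 1"] unfolding norm_of_real by linarith
  then show "(\<lambda>x. complex_of_real (a2 (x + 1) - a1 x) * f x) \<in> l2"
    using assms by (intro l2_mult_bounded) auto
qed

lemma Qeps_l2:
  assumes "f \<in> l2"
  shows "Qeps 1 p q a1 a2 b f \<in> l2" "Qeps (-1) p q a1 a2 b f \<in> l2"
  unfolding Qeps_plus_eq Qeps_minus_eq by (intro l2_scale l2_add l2_diff l2_terms assms)+

text \<open>By translation invariance \<open>?F\<close> and \<open>?G\<close> are adjoint to each
  other, and the real multiplication \<open>?D\<close> is self-adjoint. Conjugation fixes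
  \<open>c\<close> and \<open>s\<close> and exchanges the phases, which gives the coefficients of
  the other operator.\<close>

lemma ip1_Qeps:
  assumes f: "f \<in> l2" and g: "g \<in> l2"
  shows "ip1 (Qeps 1 p q a1 a2 b f) g = ip1 f (Qeps (-1) p q a1 a2 b g)"
proof -
  let ?F = "\<lambda>f x. b (x + 1) * f (x + 1)" and ?G = "\<lambda>f x. cnj (b x) * f (x - 1)"
    and ?D = "\<lambda>f x. complex_of_real (a2 (x + 1) - a1 x) * f x"
  have FG: "ip1 (?F f) g = ip1 f (?G g)" for f g
    using ip1_shift[of "\<lambda>x. b x * f x" 1 "\<lambda>x. g (x - 1)"]
    by (simp add: ip1_def mult_ac)
  have GF: "ip1 (?G f) g = ip1 f (?F g)"
    using FG[of g f] by (metis ip1_cnj)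
  have DD: "ip1 (?D f) g = ip1 f (?D g)"
    by (simp add: ip1_def mult_ac)
  \<comment> \<open>Signs are moved into the coefficients, so that additivity and scaling
    suffice.\<close>
  have "ip1 (Qeps 1 p q a1 a2 b f) g = ip1 (\<lambda>x. \<i> * (c * c * \<omega>) * ?F f x
      + (- \<i> * (s * s * \<omega>') * ?G f x + \<i> * (c * s) * ?D f x)) g"
    unfolding Qeps_plus_eq by (simp add: algebra_simps)
  also have "\<dots> = \<i> * (c * c * \<omega>) * ip1 (?F f) g
      + (- \<i> * (s * s * \<omega>') * ip1 (?G f) g + \<i> * (c * s) * ip1 (?D f) g)"
    by (simp only: ip1_add_left l2_add l2_scale l2_terms f g ip1_scale_left)
  also have "\<dots> = cnj (- \<i> * (c * c * \<omega>')) * ip1 f (?G g)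
      + (cnj (\<i> * (s * s * \<omega>)) * ip1 f (?F g) + cnj (- \<i> * (c * s)) * ip1 f (?D g))"
    by (simp add: cnj_simps FG GF DD del: of_real_diff)
  also have "\<dots> = ip1 f (\<lambda>x. - \<i> * (c * c * \<omega>') * ?G g x
      + (\<i> * (s * s * \<omega>) * ?F g x + - \<i> * (c * s) * ?D g x))"
    by (simp only: ip1_add_right l2_add l2_scale l2_terms f g ip1_scale_right)
  also have "\<dots> = ip1 f (Qeps (-1) p q a1 a2 b g)"
    unfolding Qeps_minus_eq by (simp add: algebra_simps)
  finally show ?thesis .
qed

text \<open>Adjointness turns the squared norm of \<open>Qeps 1\<close> at \<open>f\<close> into the
  inner product of \<open>f\<close> with 0.\<close>

lemma Qeps_minus_plus_eq_0:
  assumes "f \<in> l2" "Qeps (-1) p q a1 a2 b (Qeps 1 p q a1 a2 b f) = 0"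
  shows "Qeps 1 p q a1 a2 b f = 0"
  using ip1_Qeps[OF assms(1) Qeps_l2(1)[OF assms(1)]]
  unfolding assms(2) ip1_zero by (rule ip1_self_eq_0[OF Qeps_l2(1)[OF assms(1)]])

lemma Qeps_plus_minus_eq_0:
  assumes "f \<in> l2" "Qeps 1 p q a1 a2 b (Qeps (-1) p q a1 a2 b f) = 0"
  shows "Qeps (-1) p q a1 a2 b f = 0"
  using ip1_Qeps[OF Qeps_l2(2)[OF assms(1)] assms(1), symmetric]
  unfolding assms(2) ip1_zero by (rule ip1_self_eq_0[OF Qeps_l2(2)[OF assms(1)]])

lemma orth_range_Qeps:
  "orth_on ip1 l2 (Qeps 1 p q a1 a2 b ` l2) = ker_on l2 (Qeps (-1) p q a1 a2 b)"
proof
  show "orth_on ip1 l2 (Qeps 1 p q a1 a2 b ` l2) \<subseteq> ker_on l2 (Qeps (-1) p q a1 a2 b)"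
  proof
    fix g assume g: "g \<in> orth_on ip1 l2 (Qeps 1 p q a1 a2 b ` l2)"
    \<comment> \<open>Testing orthogonality on the image of \<open>Qeps (-1)\<close> at
      \<open>g\<close> yields, by adjointness, the squared norm of that vector.\<close>
    then have "g \<in> l2" "ip1 (Qeps 1 p q a1 a2 b (Qeps (-1) p q a1 a2 b g)) g = 0"
      using Qeps_l2(2)[of g] by (auto simp: orth_on_def)
    then show "g \<in> ker_on l2 (Qeps (-1) p q a1 a2 b)"
      using Qeps_l2(2)[of g] by (auto simp: ker_on_def ip1_Qeps intro: ip1_self_eq_0)
  qed
  show "ker_on l2 (Qeps (-1) p q a1 a2 b) \<subseteq> orth_on ip1 l2 (Qeps 1 p q a1 a2 b ` l2)"
    by (auto simp: ker_on_def orth_on_def ip1_Qeps ip1_zero)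
qed

section \<open>Kernels, index and the Fredholm property\<close>

lemma Hop_eps:
  "Hop p q a1 a2 b (eps p q (f, g)) = eps p q
    (Qeps (-1) p q a1 a2 b (Qeps 1 p q a1 a2 b f), Qeps 1 p q a1 a2 b (Qeps (-1) p q a1 a2 b g))"
  by (simp add: Hop_def Qop_eps)

lemma eps_eq_0: "eps p q (f, g) = 0 \<longleftrightarrow> f = 0 \<and> g = 0"
proof -
  have "eps p q (0, 0) = 0"
    by (simp add: eps_eq prod_eq_iff fun_eq_iff)
  then have "eps p q (f, g) = 0 \<longleftrightarrow> (f, g) = (0, 0)"
    using inj_eq[OF inj_eps] by metis
  then show ?thesis
    by simp
qed

text \<open>On this eigenspace \<open>H\<close> acts as \<open>Qeps (-1)\<close> after
  \<open>Qeps 1\<close>, and the outer factor adds nothing to the kernel.\<close>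

lemma ker_Hop_Hplus:
  "ker_on (Hplus p q) (Hop p q a1 a2 b) = (\<lambda>f. eps p q (f, 0)) ` ker_on l2 (Qeps 1 p q a1 a2 b)"
  by (auto simp: ker_on_def Hplus_eq Hop_eps eps_eq_0 Qeps_zero
      intro!: imageI[of _ _ "\<lambda>f. eps p q (f, 0)"] Qeps_minus_plus_eq_0)

lemma ker_Hop_Hminus:
  "ker_on (Hminus p q) (Hop p q a1 a2 b) = (\<lambda>f. eps p q (0, f)) ` ker_on l2 (Qeps (-1) p q a1 a2 b)"
  by (auto simp: ker_on_def Hminus_eq Hop_eps eps_eq_0 Qeps_zero
      intro!: imageI[of _ _ "\<lambda>f. eps p q (0, f)"] Qeps_plus_minus_eq_0)

lemma susy_index_eq:
  "susy_index p q a1 a2 b = int (cdim sc1 (ker_on l2 (Qeps 1 p q a1 a2 b)))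
     - int (cdim sc1 (ker_on l2 (Qeps (-1) p q a1 a2 b)))"
proof -
  have "inj (\<lambda>f. eps p q (f, 0))" "inj (\<lambda>f. eps p q (0, f))"
    using inj_eps by (auto simp: inj_def)
  then show ?thesis
    by (simp add: susy_index_def ker_Hop_Hplus ker_Hop_Hminus
        cdim_image[OF linear_eps_fst] cdim_image[OF linear_eps_snd])
qed

text \<open>Domain and codomain are identified with \<open>l2\<close> by different unitaries, one
  for each eigenspace. They intertwine by \<open>Qop_eps\<close> at \<open>(f, 0)\<close>, where
  \<open>Qeps_zero\<close> clears the first component.\<close>

lemma susy_fredholm_iff:
  "susy_fredholm p q a1 a2 b \<longleftrightarrow> fredholm_on sc1 sc1 ip1 ip1 l2 l2 (Qeps 1 p q a1 a2 b)"
  unfolding susy_fredholm_def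
  by (rule fredholm_on_conj[OF unitary_map_plus unitary_map_minus])
    (auto simp: l2_plus_closed l2_minus_closed l2_sc1_closed Qop_eps Qeps_zero)

end

theorem theorem3p1:
  fixes p :: real and q :: complex and a1 a2 :: "int \<Rightarrow> real" and b :: "int \<Rightarrow> complex"
  assumes "susyqw p q a1 a2 b"
  shows "unitary_on ip2 H2 (eps p q)
    \<and> (\<forall>u\<in>H2. adjoint_on ip2 H2 (eps p q) (Qop p q a1 a2 b (eps p q u))
                 = (Qeps (-1) p q a1 a2 b (snd u), Qeps 1 p q a1 a2 b (fst u)))
    \<and> (susy_fredholm p q a1 a2 b \<longleftrightarrow> fredholm_on sc1 sc1 ip1 ip1 l2 l2 (Qeps 1 p q a1 a2 b))
    \<and> (susy_fredholm p q a1 a2 b \<longrightarrow>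
           susy_index p q a1 a2 b = fred_index sc1 sc1 ip1 l2 l2 (Qeps 1 p q a1 a2 b)
         \<and> fred_index sc1 sc1 ip1 l2 l2 (Qeps 1 p q a1 a2 b)
           = int (cdim sc1 (ker_on l2 (Qeps 1 p q a1 a2 b)))
             - int (cdim sc1 (ker_on l2 (Qeps (-1) p q a1 a2 b))))"
proof -
  interpret split_step p q a1 a2 b
    by unfold_locales (rule assms)
  have "fred_index sc1 sc1 ip1 l2 l2 (Qeps 1 p q a1 a2 b)
      = int (cdim sc1 (ker_on l2 (Qeps 1 p q a1 a2 b)))
        - int (cdim sc1 (ker_on l2 (Qeps (-1) p q a1 a2 b)))"
    by (simp add: fred_index_def orth_range_Qeps)
  moreover have "adjoint_on ip2 H2 (eps p q) (Qop p q a1 a2 b (eps p q u))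
      = (Qeps (-1) p q a1 a2 b (snd u), Qeps 1 p q a1 a2 b (fst u))" if "u \<in> H2" for u
    using that unfolding Qop_eps by (intro adjoint_eps) (auto simp: H2_def Qeps_l2)
  ultimately show ?thesis
    using eps_unitary susy_index_eq susy_fredholm_iff by auto
qed

end
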